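(* Let $d\ge 1$, $L>0$, let $f:\mathbb{R}^d\to\mathbb{R}$ be convex and $L$-smooth with at least one minimizer $x_\ast$, let $\delta\in(0,1)$ and $h\in\left[0,\frac{2}{1+\delta}\right]$. Let $x_0\in\mathbb{R}^d$ and let $x_1$ be any iterate generated from $x_0$ by one step of relatively inexact gradient descent with constant normalized stepsize $h$ and relative inexactness $\delta$. Let $\tilde\lambda=\tilde\lambda(h,\delta)$ be the largest real root of the cubic equation in $\lambda$ $$\left[(\delta^2-1)h^2+2h\right]\lambda^3+\left[2(\delta^2-1)h^2+5h-4\right]\lambda^2+\left[(\delta^2-1)h^2+4h-4\right]\lambda+\left[h-1\right]=0.$$ Then $$\frac1L\|\nabla f(x_1)\|^2\le C(h,\delta)\,\bigl(f(x_0)-f(x_1)\bigr),$$ where $C(h,\delta)$ is given by the continuous function $$C(h,\delta)=\begin{cases}\dfrac{1}{h(1-\delta)}, & \text{if } h\in\left[0,\frac{3}{2(1+\delta)}\right),\\[2mm] \dfrac{2\tilde\lambda}{h\tilde\lambda^2+2(h-1)\tilde\lambda+h-1}, & \text{if } h\in\left[\frac{3}{2(1+\delta)},\frac{3\delta+2-\sqrt{4-3\delta^2}}{2\delta(\delta+1)}\right],\\[2mm] \dfrac{2}{(1-h(1+\delta))^{-2}-1}, & \text{if } h\in\left(\frac{3\delta+2-\sqrt{4-3\delta^2}}{2\delta(\delta+1)},\frac{2}{1+\delta}\right],\end{cases}$$ and $$\frac1L\|\nabla f(x_1)\|^2\le \tilde C(h,\delta)\,\bigl(f(x_0)-f(x_\ast)\bigr),$$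 where $\tilde C(h,\delta)$ is given by the continuous function $$\tilde C(h,\delta)=\begin{cases}\dfrac{1}{h(1-\delta)+\frac12}, & \text{if } h\in\left[0,\frac{3}{2(1+\delta)}\right),\\[2mm] \dfrac{2\tilde\lambda}{h\tilde\lambda^2+(2h-1)\tilde\lambda+h-1}, & \text{if } h\in\left[\frac{3}{2(1+\delta)},\frac{3\delta+2-\sqrt{4-3\delta^2}}{2\delta(\delta+1)}\right],\\[2mm] 2(1-h(1+\delta))^2, & \text{if } h\in\left(\frac{3\delta+2-\sqrt{4-3\delta^2}}{2\delta(\delta+1)},\frac{2}{1+\delta}\right].\end{cases}$$
   Context: $\|\cdot\|$ is the Euclidean norm. A differentiable function $f:\mathbb{R}^d\to\mathbb{R}$ is $L$-smooth if $\|\nabla f(x)-\nabla f(y)\|\le L\|x-y\|$ for all $x,y\in\mathbb{R}^d$. One step of relatively inexact gradient descent with normalized stepsize $h$ and relative inexactness $\delta$: from $x_0$, an arbitrary vector $d_0\in\mathbb{R}^d$ satisfying $\|d_0-\nabla f(x_0)\|\le\delta\|\nabla f(x_0)\|$ is used as approximate gradient, and $x_1=x_0-\frac{h}{L}d_0$.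
   Formalization: At h=0 and h=2/(1+δ) the formula for C(h,δ) divides by zero, so C is taken there as +∞ (continuity of C is in the extended reals), and the first bound at these two values is read as f(x_1) ≤ f(x_0). *)

theory Defs
  imports "HOL-Analysis.Analysis"
begin

definition gradient :: "('a::euclidean_space \<Rightarrow> real) \<Rightarrow> 'a \<Rightarrow> 'a" where
  "gradient f x = (THE D. GDERIV f x :> D)"

lemma gradient_eqI:
  assumes "GDERIV f x :> D"
  shows "gradient f x = D"
  unfolding gradient_def
proof (rule the_equality[where a = D])
  show "GDERIV f x :> D" by fact
next
  fix E assume "GDERIV f x :> E"
  then have "(\<lambda>h. inner h E) = (\<lambda>h. inner h D)"
    using assms unfolding gderiv_def by (rule has_derivative_unique)
  then have "inner h E = inner h D" for h
    by (rule fun_cong)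
  then show "E = D"
    by (metis vector_eq_ldot)
qed

definition L_smooth :: "real \<Rightarrow> ('a::euclidean_space \<Rightarrow> real) \<Rightarrow> bool" where
  "L_smooth L f \<longleftrightarrow>
     (\<forall>x. f differentiable (at x)) \<and>
     (\<forall>x y. norm (gradient f x - gradient f y) \<le> L * norm (x - y))"

definition inexact_gd_step ::
  "real \<Rightarrow> real \<Rightarrow> real \<Rightarrow> ('a::euclidean_space \<Rightarrow> real) \<Rightarrow> 'a \<Rightarrow> 'a \<Rightarrow> bool" where
  "inexact_gd_step L h \<delta> f x0 x1 \<longleftrightarrow>
     (\<exists>d0. norm (d0 - gradient f x0) \<le> \<delta> * norm (gradient f x0) \<and>
           x1 = x0 - (h / L) *\<^sub>R d0)"

definition cubic :: "real \<Rightarrow> real \<Rightarrow> real \<Rightarrow> real" where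
  "cubic h \<delta> l =
     ((\<delta>^2 - 1) * h^2 + 2 * h) * l^3
     + (2 * (\<delta>^2 - 1) * h^2 + 5 * h - 4) * l^2
     + ((\<delta>^2 - 1) * h^2 + 4 * h - 4) * l
     + (h - 1)"

text \<open>For \<open>0 < \<delta> < 1\<close> and \<open>0 < h \<le> 2 / (1 + \<delta>)\<close> the leading coefficient is positive, so the set
  of real roots is finite and nonempty and \<^const>\<open>Max\<close> is the largest root. The functions below use it
  only for such \<open>h\<close>.\<close>

definition lam :: "real \<Rightarrow> real \<Rightarrow> real" where
  "lam h \<delta> = Max {l. cubic h \<delta> l = 0}"

definition h_low :: "real \<Rightarrow> real" where
  "h_low \<delta> = 3 / (2 * (1 + \<delta>))"

definition h_high :: "real \<Rightarrow> real" where
  "h_high \<delta> = (3 * \<delta> + 2 - sqrt (4 - 3 * \<delta>^2)) / (2 * \<delta> * (\<delta> + 1))"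

text \<open>The denominators of the first and the last branch of \<open>C_step\<close> vanish at \<open>h = 0\<close> and at
  \<open>h = 2 / (1 + \<delta>)\<close> respectively. There the value of the continuous function is \<open>\<infinity>\<close>, which is what
  the division of \<^typ>\<open>ereal\<close> yields; division of reals would yield \<open>0\<close>.
  For \<open>C = \<infinity>\<close> the bound \<open>A \<le> C * B\<close> cannot be stated by multiplication in \<^typ>\<open>ereal\<close>, where
  \<open>\<infinity> * 0 = 0\<close> (and \<open>B = 0\<close> does occur, always so at \<open>h = 0\<close>); it is then read as its limit
  \<open>A / C \<le> B\<close> with \<open>A / \<infinity> = 0\<close>, that is, \<open>0 \<le> B\<close>.\<close>

definition C_step :: "real \<Rightarrow> real \<Rightarrow> ereal" where
  "C_step h \<delta> =
     (if h < h_low \<delta> then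
        1 / ereal (h * (1 - \<delta>))
      else if h \<le> h_high \<delta> then
        ereal (2 * lam h \<delta> / (h * (lam h \<delta>)^2 + 2 * (h - 1) * lam h \<delta> + h - 1))
      else
        2 / ereal ((1 - h * (1 + \<delta>)) powi (-2) - 1))"

definition C_min :: "real \<Rightarrow> real \<Rightarrow> real" where
  "C_min h \<delta> =
     (if h < h_low \<delta> then
        1 / (h * (1 - \<delta>) + 1 / 2)
      else if h \<le> h_high \<delta> then
        2 * lam h \<delta> / (h * (lam h \<delta>)^2 + (2 * h - 1) * lam h \<delta> + h - 1)
      else
        2 * (1 - h * (1 + \<delta>))^2)"

definition params :: "(real \<times> real) set" where
  "params = {(h, \<delta>). 0 < \<delta> \<and> \<delta> < 1 \<and> 0 \<le> h \<and> h \<le> 2 / (1 + \<delta>)}"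

lemma C_step_eq_PInfty_iff:
  assumes \<delta>: "0 < \<delta>" "\<delta> < 1" and h: "0 \<le> h" "h \<le> 2 / (1 + \<delta>)"
  shows "C_step h \<delta> = \<infinity> \<longleftrightarrow> h = 0 \<or> h = 2 / (1 + \<delta>)"
proof -
  have low: "0 < h_low \<delta>" "h_low \<delta> < 2 / (1 + \<delta>)"
    using \<delta> by (simp_all add: h_low_def field_simps)
  have sq: "2 - \<delta> < sqrt (4 - 3 * \<delta>^2)"
  proof (rule real_less_rsqrt)
    have "\<delta> * \<delta> < \<delta> * 1"
      using \<delta> by (intro mult_strict_left_mono) auto
    then show "(2 - \<delta>)\<^sup>2 < 4 - 3 * \<delta>^2"
      by (simp add: power2_eq_square algebra_simps)
  qed
  have high: "h_high \<delta> < 2 / (1 + \<delta>)"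
  proof -
    have "h_high \<delta> < ((2 * \<delta>) * 2) / ((2 * \<delta>) * (\<delta> + 1))"
      unfolding h_high_def using \<delta> sq by (intro divide_strict_right_mono) auto
    also have "\<dots> = 2 / (1 + \<delta>)"
      using \<delta> by (subst mult_divide_mult_cancel_left) (auto simp: add.commute)
    finally show ?thesis .
  qed
  consider "h < h_low \<delta>" | "h_low \<delta> \<le> h" "h \<le> h_high \<delta>" | "h_low \<delta> \<le> h" "h_high \<delta> < h"
    by linarith
  then show ?thesis
  proof cases
    case 1
    then have "C_step h \<delta> = ereal 1 / ereal (h * (1 - \<delta>))"
      by (simp only: C_step_def if_True one_ereal_def)
    moreover have "h * (1 - \<delta>) = 0 \<longleftrightarrow> h = 0"
      using \<delta> by simp
    moreover have "h \<noteq> 2 / (1 + \<delta>)"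
      using 1 low by linarith
    ultimately show ?thesis
      by simp
  next
    case 2
    then show ?thesis
      using low high by (simp add: C_step_def)
  next
    case 3
    define s where "s = h * (1 + \<delta>) - 1"
    have s: "1 / 2 \<le> s"
      using 3(1) \<delta> by (simp add: s_def h_low_def field_simps)
    have "(1 - h * (1 + \<delta>)) powi (-2) = inverse (s^2)"
      by (simp add: power_int_minus s_def power2_commute)
    moreover have "inverse (s^2) - 1 = 0 \<longleftrightarrow> s = 1"
      using s by (simp add: power2_eq_1_iff)
    moreover have "s = 1 \<longleftrightarrow> h = 2 / (1 + \<delta>)"
      using \<delta> by (auto simp: s_def field_simps)
    moreover have "C_step h \<delta> = ereal 2 / ereal ((1 - h * (1 + \<delta>)) powi (-2) - 1)"
      using 3 by (simp add: C_step_def)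
    moreover have "h \<noteq> 0"
      using 3 low by linarith
    ultimately show ?thesis
      by simp
  qed
qed

end

theory Submission
  imports Defs
begin

text \<open>Write \<open>g\<^sub>0\<close>, \<open>g\<^sub>1\<close> for the gradients at \<open>x\<^sub>0\<close>, \<open>x\<^sub>1\<close> and take \<open>L = 1\<close>. Adding the smooth convex
  interpolation inequalities between \<open>x\<^sub>0\<close> and \<open>x\<^sub>1\<close> with weights \<open>1 + b\<close> and \<open>b\<close>, and minimising over the
  inexact gradient, bounds \<open>f x\<^sub>0 - f x\<^sub>1\<close> from below by a function of \<open>g\<^sub>0\<close> and \<open>g\<^sub>1\<close>. With
  \<open>s = h (1 + \<delta>) - 1\<close>, this function dominates \<open>norm g\<^sub>1 ^ 2 / C\<close> in the three regimes for the multipliers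
  \<open>b = 1\<close>, \<open>b = \<lambda>\<close> and \<open>b = 1 / s - 1\<close> respectively. In the middle regime, dividing the cubic by
  \<open>(1 + \<lambda>)\<^sup>2\<close> makes it strictly increasing on \<open>[1 / s - 1, \<infinity>)\<close>, with a sign change on \<open>[1 / s - 1, 1]\<close>: this
  locates the largest root and gives its continuity. Combining the bound with
  \<open>f x\<^sub>* \<le> f x\<^sub>1 - norm g\<^sub>1 ^ 2 / 2\<close> yields the second estimate, with
  \<open>1 / C_min = 1 / C_step + 1 / 2\<close>.\<close>

subsection \<open>Smooth convex functions\<close>

lemma has_gradient_gradient:
  fixes f :: "'a::euclidean_space \<Rightarrow> real"
  assumes "f differentiable (at x)"
  shows "GDERIV f x :> gradient f x"
proof -
  from assms obtain f' where f': "(f has_derivative f') (at x)"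
    by (auto simp: differentiable_def)
  then have lin: "linear f'"
    by (rule has_derivative_linear)
  \<comment> \<open>\<open>adjoint f' 1\<close> is the Riesz representative of the functional
    \<open>f'\<close>.\<close>
  have "f' = (\<lambda>h. inner h (adjoint f' 1))"
    by (simp add: fun_eq_iff adjoint_works[OF lin])
  then have "GDERIV f x :> adjoint f' 1"
    using f' by (simp add: gderiv_def)
  then show ?thesis
    using gradient_eqI by metis
qed

lemma gderiv_along_line:
  assumes "GDERIV f (x + t *\<^sub>R v) :> D"
  shows "((\<lambda>t. f (x + t *\<^sub>R v)) has_real_derivative inner v D) (at t)"
proof -
  have "((\<lambda>t. f (x + t *\<^sub>R v)) has_derivative (\<lambda>u. inner (u *\<^sub>R v) D)) (at t)"
    by (rule has_derivative_compose[where g = f and g' = "\<lambda>h. inner h D"])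
      (use assms in \<open>auto simp: gderiv_def intro!: derivative_eq_intros\<close>)
  then show ?thesis
    by (simp add: has_field_derivative_def mult.commute[of _ "inner v D"] fun_eq_iff)
qed

text \<open>Restriction to the line through \<open>x\<close> and \<open>y\<close> reduces this to
  the tangent inequality for convex functions of one variable.\<close>

lemma convex_above_gradient:
  assumes cvx: "convex_on UNIV f" and D: "GDERIV f x :> D"
  shows "f x + inner D (y - x) \<le> f y"
proof -
  define \<phi> where "\<phi> t = f (x + t *\<^sub>R (y - x))" for t
  have "convex_on UNIV \<phi>"
  proof (rule convex_onI)
    fix t a b :: real assume t: "0 < t" "t < 1"
    have "x + ((1 - t) *\<^sub>R a + t *\<^sub>R b) *\<^sub>R (y - x)
        = (1 - t) *\<^sub>R (x + a *\<^sub>R (y - x)) + t *\<^sub>R (x + b *\<^sub>R (y - x))"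
      by (simp add: algebra_simps)
    then show "\<phi> ((1 - t) *\<^sub>R a + t *\<^sub>R b) \<le> (1 - t) * \<phi> a + t * \<phi> b"
      unfolding \<phi>_def using convex_onD[OF cvx] t by simp
  qed simp
  moreover have "(\<phi> has_real_derivative inner (y - x) D) (at 0)"
    unfolding \<phi>_def by (rule gderiv_along_line) (simp add: D)
  ultimately have "inner (y - x) D * (1 - 0) \<le> \<phi> 1 - \<phi> 0"
    using convex_on_imp_above_tangent[of UNIV \<phi> 0 1 "inner (y - x) D"] by simp
  then show ?thesis
    by (simp add: \<phi>_def inner_commute)
qed

text \<open>Along the segment, \<open>f\<close> minus its quadratic model has nonpositive
  derivative, by Cauchy-Schwarz and the Lipschitz bound on the gradient.\<close>

lemma L_smooth_descent:
  assumes "L_smooth L f"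
  shows "f y \<le> f x + inner (gradient f x) (y - x) + L / 2 * (norm (y - x))\<^sup>2"
proof -
  define v where "v = y - x"
  define g where "g z = gradient f z" for z
  define \<phi> where "\<phi> t = f (x + t *\<^sub>R v) - t * inner v (g x) - L / 2 * t\<^sup>2 * (norm v)\<^sup>2" for t
  have "\<phi> 1 \<le> \<phi> 0"
  proof (rule DERIV_nonpos_imp_nonincreasing[where f = \<phi> and a = 0 and b = 1])
    fix t :: real assume t: "0 \<le> t" "t \<le> 1"
    have "GDERIV f (x + t *\<^sub>R v) :> g (x + t *\<^sub>R v)"
      using assms unfolding g_def by (intro has_gradient_gradient) (simp add: L_smooth_def)
    then have "(\<phi> has_real_derivative
        inner v (g (x + t *\<^sub>R v)) - inner v (g x) - L * t * (norm v)\<^sup>2) (at t)"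
      unfolding \<phi>_def by (auto intro!: derivative_eq_intros gderiv_along_line)
    moreover have "inner v (g (x + t *\<^sub>R v)) - inner v (g x) - L * t * (norm v)\<^sup>2 \<le> 0"
    proof -
      have "inner v (g (x + t *\<^sub>R v)) - inner v (g x) \<le> norm v * norm (g (x + t *\<^sub>R v) - g x)"
        by (simp add: inner_diff_right[symmetric] norm_cauchy_schwarz)
      also have "\<dots> \<le> norm v * (L * norm (x + t *\<^sub>R v - x))"
        using assms unfolding g_def by (intro mult_left_mono) (simp_all only: L_smooth_def norm_ge_zero)
      also have "\<dots> = L * t * (norm v)\<^sup>2"
        using t by (simp add: power2_eq_square)
      finally show ?thesis by simp
    qed
    ultimately show "\<exists>y. DERIV \<phi> t :> y \<and> y \<le> 0" by blast
  qed simp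
  then show ?thesis
    by (simp add: \<phi>_def v_def g_def inner_commute)
qed

lemma gradient_step_decrease:
  assumes "L_smooth L f" and "L > 0"
  shows "f (x - (1 / L) *\<^sub>R gradient f x) \<le> f x - (norm (gradient f x))\<^sup>2 / (2 * L)"
proof -
  define g where "g = gradient f x"
  have "f (x - (1 / L) *\<^sub>R g) \<le> f x - inner g g / L + L / 2 * (norm g / L)\<^sup>2"
    using L_smooth_descent[OF assms(1), of "x - (1 / L) *\<^sub>R g" x] \<open>L > 0\<close>
    by (simp add: g_def)
  also have "\<dots> = f x - (norm g)\<^sup>2 / (2 * L)"
    using \<open>L > 0\<close> by (simp add: power2_norm_eq_inner[symmetric] power2_eq_square field_simps)
  finally show ?thesis by (simp add: g_def)
qed

lemma smooth_convex_interpolation: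
  assumes smooth: "L_smooth L f" and cvx: "convex_on UNIV f" and L: "L > 0"
  shows "f x + inner (gradient f x) (y - x) + (norm (gradient f x - gradient f y))\<^sup>2 / (2 * L) \<le> f y"
proof -
  define u where "u = gradient f y - gradient f x"
  \<comment> \<open>This \<open>z\<close> minimises the quadratic upper model at \<open>y\<close>
    minus the tangent at \<open>x\<close>, so comparing both with \<open>f z\<close> gives the
    strongest inequality.\<close>
  define z where "z = y - (1 / L) *\<^sub>R u"
  have "f x + inner (gradient f x) (z - x) \<le> f z"
    using smooth by (intro convex_above_gradient cvx has_gradient_gradient) (simp add: L_smooth_def)
  also have "\<dots> \<le> f y + inner (gradient f y) (z - y) + L / 2 * (norm (z - y))\<^sup>2"
    by (rule L_smooth_descent[OF smooth])
  finally have "f x + inner (gradient f x) (z - x) - inner (gradient f y) (z - y)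
      - L / 2 * (norm (z - y))\<^sup>2 \<le> f y"
    by simp
  moreover have "inner (gradient f x) (z - x) - inner (gradient f y) (z - y)
      = inner (gradient f x) (y - x) + (norm u)\<^sup>2 / L"
    by (simp add: z_def u_def power2_norm_eq_inner algebra_simps inner_diff_left inner_diff_right
        diff_divide_distrib add_divide_distrib inner_commute)
  moreover have "L / 2 * (norm (z - y))\<^sup>2 = (norm u)\<^sup>2 / (2 * L)"
    using L by (simp add: z_def power2_eq_square)
  moreover have "(norm u)\<^sup>2 / L - (norm u)\<^sup>2 / (2 * L) = (norm u)\<^sup>2 / (2 * L)"
    using L by (simp add: field_simps)
  ultimately show ?thesis
    by (simp add: u_def norm_minus_commute)
qed

text \<open>The weights \<open>1 + b\<close> and \<open>b\<close> on the two interpolation inequalities leave a quantity that is affine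
  in the inexact gradient, so its minimum over the ball around the exact gradient is explicit; it depends
  only on \<open>p = norm v\<close>, \<open>q = norm g\<^sub>0\<close> and \<open>c = inner v g\<^sub>0\<close>, where \<open>v = (1 + b) g\<^sub>1 - b g\<^sub>0\<close>.\<close>

lemma inexact_gd_step_decrease:
  assumes smooth: "L_smooth L f" and cvx: "convex_on UNIV f" and L: "L > 0"
    and step: "inexact_gd_step L h \<delta> f x0 x1" and h: "0 \<le> h" and b: "0 \<le> b"
    and form: "\<And>p q c. 0 \<le> p \<Longrightarrow> 0 \<le> q \<Longrightarrow> \<bar>c\<bar> \<le> p * q \<Longrightarrow>
      K * (p\<^sup>2 + 2 * b * c + b\<^sup>2 * q\<^sup>2)
        \<le> (1 + b)\<^sup>2 * h * (c - \<delta> * p * q) + (1 + 2 * b) / 2 * (p\<^sup>2 - 2 * c + q\<^sup>2)"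
  shows "K / L * (norm (gradient f x1))\<^sup>2 \<le> f x0 - f x1"
proof -
  define g0 g1 where "g0 = gradient f x0" and "g1 = gradient f x1"
  obtain d where d: "norm (d - g0) \<le> \<delta> * norm g0" and x1: "x1 = x0 - (h / L) *\<^sub>R d"
    using step by (auto simp: inexact_gd_step_def g0_def)
  define v where "v = (1 + b) *\<^sub>R g1 - b *\<^sub>R g0"
  have I1: "h / L * inner g1 d + (norm (g0 - g1))\<^sup>2 / (2 * L) \<le> f x0 - f x1"
    using smooth_convex_interpolation[OF smooth cvx L, of x1 x0]
    unfolding g0_def[symmetric] g1_def[symmetric] by (simp add: x1 norm_minus_commute)
  have I2: "f x0 - f x1 \<le> h / L * inner g0 d - (norm (g0 - g1))\<^sup>2 / (2 * L)"
    using smooth_convex_interpolation[OF smooth cvx L, of x0 x1]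
    unfolding g0_def[symmetric] g1_def[symmetric] by (simp add: x1)
  have "f x0 - f x1 \<ge> (1 + b) * (h / L * inner g1 d + (norm (g0 - g1))\<^sup>2 / (2 * L))
      - b * (h / L * inner g0 d - (norm (g0 - g1))\<^sup>2 / (2 * L))"
    using mult_left_mono[OF I1, of "1 + b"] mult_left_mono[OF I2, of b] b
    by (simp add: algebra_simps)
  also have "(1 + b) * (h / L * inner g1 d + (norm (g0 - g1))\<^sup>2 / (2 * L))
      - b * (h / L * inner g0 d - (norm (g0 - g1))\<^sup>2 / (2 * L))
      = (h * inner v d + (1 + 2 * b) / 2 * (norm (g0 - g1))\<^sup>2) / L"
    using L by (simp add: v_def field_simps inner_diff_left inner_add_left)
  finally have main: "(h * inner v d + (1 + 2 * b) / 2 * (norm (g0 - g1))\<^sup>2) / L \<le> f x0 - f x1" .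
  have "inner v d = inner v g0 + inner v (d - g0)"
    by (simp add: inner_diff_right)
  moreover have "- (norm v * (\<delta> * norm g0)) \<le> inner v (d - g0)"
    using Cauchy_Schwarz_ineq2[of v "d - g0"] mult_left_mono[OF d, of "norm v"] by auto
  ultimately have vd: "inner v g0 - \<delta> * norm v * norm g0 \<le> inner v d"
    by (simp add: ac_simps)
  \<comment> \<open>The next two identities are squares of \<open>(1 + b) g1 = v + b g0\<close> and
    \<open>(1 + b) (g0 - g1) = g0 - v\<close>.\<close>
  have g1': "(1 + b)\<^sup>2 * (norm g1)\<^sup>2 = (norm v)\<^sup>2 + 2 * b * inner v g0 + b\<^sup>2 * (norm g0)\<^sup>2"
    unfolding power2_norm_eq_inner v_def inner_diff_left inner_diff_right inner_scaleR_left
      inner_scaleR_right inner_commute[of g1 g0]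
    by (simp only: power2_eq_square) (simp add: algebra_simps)
  have g01: "(1 + b)\<^sup>2 * (norm (g0 - g1))\<^sup>2 = (norm v)\<^sup>2 - 2 * inner v g0 + (norm g0)\<^sup>2"
    unfolding power2_norm_eq_inner v_def inner_diff_left inner_diff_right inner_scaleR_left
      inner_scaleR_right inner_commute[of g1 g0]
    by (simp only: power2_eq_square) (simp add: algebra_simps)
  have "(1 + b)\<^sup>2 * (K * (norm g1)\<^sup>2) = K * ((norm v)\<^sup>2 + 2 * b * inner v g0 + b\<^sup>2 * (norm g0)\<^sup>2)"
    unfolding g1'[symmetric] by simp
  also have "\<dots> \<le> (1 + b)\<^sup>2 * h * (inner v g0 - \<delta> * norm v * norm g0)
      + (1 + 2 * b) / 2 * ((norm v)\<^sup>2 - 2 * inner v g0 + (norm g0)\<^sup>2)"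
    by (rule form) (simp_all add: Cauchy_Schwarz_ineq2)
  also have "\<dots> \<le> (1 + b)\<^sup>2 * h * inner v d + (1 + 2 * b) / 2 * ((1 + b)\<^sup>2 * (norm (g0 - g1))\<^sup>2)"
    unfolding g01 using vd h by (intro add_right_mono mult_left_mono) auto
  also have "\<dots> = (1 + b)\<^sup>2 * (h * inner v d + (1 + 2 * b) / 2 * (norm (g0 - g1))\<^sup>2)"
    by (simp add: algebra_simps)
  finally have "K * (norm g1)\<^sup>2 \<le> h * inner v d + (1 + 2 * b) / 2 * (norm (g0 - g1))\<^sup>2"
    using b by (simp add: mult_le_cancel_left_pos)
  then have "K * (norm g1)\<^sup>2 / L \<le> (h * inner v d + (1 + 2 * b) / 2 * (norm (g0 - g1))\<^sup>2) / L"
    using L by (intro divide_right_mono) auto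
  with main show ?thesis
    by (simp add: g1_def)
qed

subsection \<open>Quadratic forms of the three regimes\<close>

text \<open>For \<open>b = 1\<close> the gap is a combination of \<open>(p - q)\<^sup>2\<close> and
  \<open>p * q - c\<close>; the coefficient of the latter changes sign exactly at
  \<open>h * (1 + \<delta>) = 3 / 2\<close>.\<close>

lemma short_step_form:
  fixes h \<delta> p q c :: real
  assumes \<delta>: "0 \<le> \<delta>" and h: "0 \<le> h" "h * (1 + \<delta>) \<le> 3 / 2" and c: "\<bar>c\<bar> \<le> p * q"
  shows "h * (1 - \<delta>) * (p\<^sup>2 + 2 * 1 * c + 1\<^sup>2 * q\<^sup>2)
    \<le> (1 + 1)\<^sup>2 * h * (c - \<delta> * p * q) + (1 + 2 * 1) / 2 * (p\<^sup>2 - 2 * c + q\<^sup>2)"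
proof -
  have "0 \<le> h * \<delta>" using \<delta> h by simp
  then have "0 \<le> (3 / 2 - h * (1 - \<delta>)) * (p - q)\<^sup>2"
    using h by (intro mult_nonneg_nonneg) (simp_all add: algebra_simps)
  moreover have "0 \<le> (3 - 2 * (h * (1 + \<delta>))) * (p * q - c)"
    using h c by (intro mult_nonneg_nonneg) auto
  moreover have "(1 + 1)\<^sup>2 * h * (c - \<delta> * p * q) + (1 + 2 * 1) / 2 * (p\<^sup>2 - 2 * c + q\<^sup>2)
      - h * (1 - \<delta>) * (p\<^sup>2 + 2 * 1 * c + 1\<^sup>2 * q\<^sup>2)
    = (3 / 2 - h * (1 - \<delta>)) * (p - q)\<^sup>2 + (3 - 2 * (h * (1 + \<delta>))) * (p * q - c)"
    by (simp add: power2_eq_square algebra_simps)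
  ultimately show ?thesis by linarith
qed

text \<open>The value of \<open>K\<close> makes the coefficient of \<open>c\<close> vanish; the product equation says that the remaining
  quadratic form in \<open>p\<close> and \<open>q\<close> is degenerate, and it is the cubic equation for \<open>b\<close>.\<close>

lemma middle_step_form:
  fixes h \<delta> p q c b K :: real
  assumes b: "0 < b" and K: "2 * b * K = h * (1 + b)\<^sup>2 - (1 + 2 * b)"
    and A: "0 \<le> 2 * b + 1 - h * (1 + b)" and B: "0 \<le> 2 * b + 1 - b * h * (1 + b)"
    and AB: "(2 * b + 1 - h * (1 + b)) * (2 * b + 1 - b * h * (1 + b)) = b * (h * \<delta> * (1 + b))\<^sup>2"
    and pq: "0 \<le> p" "0 \<le> q"
  shows "K * (p\<^sup>2 + 2 * b * c + b\<^sup>2 * q\<^sup>2)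
    \<le> (1 + b)\<^sup>2 * h * (c - \<delta> * p * q) + (1 + 2 * b) / 2 * (p\<^sup>2 - 2 * c + q\<^sup>2)"
proof -
  define A where "A = 2 * b + 1 - h * (1 + b)"
  define B where "B = 2 * b + 1 - b * h * (1 + b)"
  \<comment> \<open>By degeneracy the cross coefficient is the geometric mean of the two diagonal
    ones, so the form is bounded below by a perfect square.\<close>
  have "(b * h * \<delta> * (1 + b))\<^sup>2 = A * (b * B)"
    using AB by (simp add: A_def B_def power2_eq_square ac_simps)
  then have "\<bar>b * h * \<delta> * (1 + b)\<bar> = sqrt A * sqrt (b * B)"
    by (metis real_sqrt_abs real_sqrt_mult)
  then have "b * h * \<delta> * (1 + b) \<le> sqrt A * sqrt (b * B)"
    by linarith
  then have "2 * (b * h * \<delta> * (1 + b)) * (p * q) \<le> 2 * (sqrt A * sqrt (b * B)) * (p * q)"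
    using pq by (intro mult_right_mono) auto
  also have "\<dots> = 2 * (sqrt A * p) * (sqrt (b * B) * q)"
    by simp
  also have "\<dots> \<le> (sqrt A * p)\<^sup>2 + (sqrt (b * B) * q)\<^sup>2"
    by (rule sum_squares_bound)
  also have "\<dots> = A * p\<^sup>2 + b * B * q\<^sup>2"
    using A B b by (simp add: power_mult_distrib A_def B_def)
  finally have "0 \<le> (1 + b) * (A * p\<^sup>2 + b * B * q\<^sup>2 - 2 * (b * h * \<delta> * (1 + b)) * (p * q))"
    using b by simp
  \<comment> \<open>The factor \<open>2 * b\<close> clears the denominator of \<open>K\<close>; all
    terms in \<open>c\<close> then cancel.\<close>
  also have "\<dots> = 2 * b * ((1 + b)\<^sup>2 * h * (c - \<delta> * p * q)
      + (1 + 2 * b) / 2 * (p\<^sup>2 - 2 * c + q\<^sup>2)) - (2 * b * K) * (p\<^sup>2 + 2 * b * c + b\<^sup>2 * q\<^sup>2)"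
    unfolding K by (simp add: A_def B_def power2_eq_square field_simps)
  also have "\<dots> = 2 * b * ((1 + b)\<^sup>2 * h * (c - \<delta> * p * q)
      + (1 + 2 * b) / 2 * (p\<^sup>2 - 2 * c + q\<^sup>2) - K * (p\<^sup>2 + 2 * b * c + b\<^sup>2 * q\<^sup>2))"
    by (simp add: algebra_simps)
  finally show ?thesis
    using b by (simp add: zero_le_mult_iff)
qed

text \<open>In terms of \<open>u = 1 / s = 1 + b\<close>, the gap is a combination of
  \<open>c + p * q\<close> and \<open>(p - u * q)\<^sup>2\<close>. The hypothesis \<open>hs\<close>
  is the sign of the first coefficient, and \<open>s \<ge> 1 / 2\<close>, that is
  \<open>u \<le> 2\<close>, that of the second.\<close>

lemma long_step_form:
  fixes h \<delta> p q c s b :: real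
  assumes s: "s = h * (1 + \<delta>) - 1" "1 / 2 \<le> s" and hs: "s\<^sup>2 - s + 1 \<le> h * s"
    and b: "b = 1 / s - 1" and c: "\<bar>c\<bar> \<le> p * q"
  shows "(1 / s\<^sup>2 - 1) / 2 * (p\<^sup>2 + 2 * b * c + b\<^sup>2 * q\<^sup>2)
    \<le> (1 + b)\<^sup>2 * h * (c - \<delta> * p * q) + (1 + 2 * b) / 2 * (p\<^sup>2 - 2 * c + q\<^sup>2)"
proof -
  define u where "u = 1 / s"
  have u: "0 < u" "u \<le> 2" "s = 1 / u" using s by (auto simp: u_def field_simps)
  \<comment> \<open>Eliminates \<delta> through \<open>h * \<delta> = 1 + s - h\<close>.\<close>
  have hd: "h * \<delta> * u\<^sup>2 = u\<^sup>2 + u - h * u\<^sup>2"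
  proof -
    have "h * \<delta> = 1 + 1 / u - h" using s u by (simp add: algebra_simps)
    then show ?thesis using u by (simp only:) (simp add: power2_eq_square field_simps)
  qed
  have "0 \<le> u ^ 3 * (h * s - (s\<^sup>2 - s + 1))"
    using hs u by (intro mult_nonneg_nonneg) auto
  also have "u ^ 3 * (h * s - (s\<^sup>2 - s + 1)) = h * u\<^sup>2 - u + u\<^sup>2 - u ^ 3"
    using u(1) unfolding u(3) by (simp add: power2_eq_square power3_eq_cube field_simps)
  finally have m: "0 \<le> h * u\<^sup>2 - u + u\<^sup>2 - u ^ 3" .
  have "0 \<le> (h * u\<^sup>2 - u + u\<^sup>2 - u ^ 3) * (c + p * q)"
    using m c by (intro mult_nonneg_nonneg) auto
  moreover have "0 \<le> u * (2 - u) / 2 * (p - u * q)\<^sup>2"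
    using u by (intro mult_nonneg_nonneg) auto
  moreover have "u\<^sup>2 * h * (c - \<delta> * p * q) = h * u\<^sup>2 * c - (u\<^sup>2 + u - h * u\<^sup>2) * (p * q)"
    unfolding hd[symmetric] by (simp add: algebra_simps)
  moreover have "h * u\<^sup>2 * c - (u\<^sup>2 + u - h * u\<^sup>2) * (p * q) + (2 * u - 1) / 2 * (p\<^sup>2 - 2 * c + q\<^sup>2)
      - (u\<^sup>2 - 1) / 2 * (p\<^sup>2 + 2 * (u - 1) * c + (u - 1)\<^sup>2 * q\<^sup>2)
      = (h * u\<^sup>2 - u + u\<^sup>2 - u ^ 3) * (c + p * q) + u * (2 - u) / 2 * (p - u * q)\<^sup>2"
    by (simp add: power2_eq_square power3_eq_cube field_simps)
  ultimately have "(u\<^sup>2 - 1) / 2 * (p\<^sup>2 + 2 * (u - 1) * c + (u - 1)\<^sup>2 * q\<^sup>2)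
      \<le> u\<^sup>2 * h * (c - \<delta> * p * q) + (2 * u - 1) / 2 * (p\<^sup>2 - 2 * c + q\<^sup>2)"
    by linarith
  moreover have "1 / s\<^sup>2 = u\<^sup>2" "b = u - 1"
    by (simp_all add: u_def b power_divide)
  ultimately show ?thesis by simp
qed

subsection \<open>The middle regime and the largest root of the cubic\<close>

text \<open>The residual is a quadratic in \<open>h\<close> with leading coefficient
  \<open>D / 2\<close> and smaller root \<open>h_high \<delta>\<close>. Its other root
  \<open>h'\<close> lies beyond \<open>2 / (1 + \<delta>)\<close>, so on the admissible range the
  sign of the residual is that of \<open>h_high \<delta> - h\<close>.\<close>

lemma h_high_residual:
  assumes \<delta>: "0 < \<delta>" "\<delta> < 1" and h: "h \<le> 2 / (1 + \<delta>)" and s: "s = h * (1 + \<delta>) - 1"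
  obtains c where "c > 0" "s\<^sup>2 - s + 1 - h * s = c * (h_high \<delta> - h)"
proof
  define r where "r = sqrt (4 - 3 * \<delta>\<^sup>2)"
  define D where "D = 2 * \<delta> * (\<delta> + 1)"
  define h' where "h' = (3 * \<delta> + 2 + r) / D"
  have "\<delta>\<^sup>2 \<le> 1" using \<delta> by (simp add: power_le_one)
  then have r2: "r\<^sup>2 = 4 - 3 * \<delta>\<^sup>2" and r0: "0 \<le> r" by (simp_all add: r_def)
  have D: "D > 0" using \<delta> by (simp add: D_def)
  have "2 / (1 + \<delta>) = 4 * \<delta> / D"
    using \<delta> by (simp add: D_def frac_eq_eq)
  also have "\<dots> < h'"
    unfolding h'_def using D r0 \<delta> by (intro divide_strict_right_mono) auto
  finally show "0 < D / 2 * (h' - h)"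
    using h D by simp
  have high: "h_high \<delta> = (3 * \<delta> + 2 - r) / D"
    by (simp add: h_high_def r_def D_def)
  have "(h_high \<delta> - h) * (h' - h) * D\<^sup>2 = (3 * \<delta> + 2 - r - h * D) * (3 * \<delta> + 2 + r - h * D)"
    using D by (simp add: high h'_def power2_eq_square field_simps)
  also have "\<dots> = (3 * \<delta> + 2 - h * D)\<^sup>2 - r\<^sup>2"
    by (simp add: power2_eq_square algebra_simps)
  also have "\<dots> = 2 * D * (s\<^sup>2 - s + 1 - h * s)"
    unfolding r2 by (simp add: D_def s power2_eq_square algebra_simps)
  finally have "D * (2 * (s\<^sup>2 - s + 1 - h * s)) = D * (D * (h_high \<delta> - h) * (h' - h))"
    by (simp only: power2_eq_square ac_simps)
  then have "2 * (s\<^sup>2 - s + 1 - h * s) = D * (h_high \<delta> - h) * (h' - h)"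
    using D by (simp only: mult_cancel_left) auto
  then show "s\<^sup>2 - s + 1 - h * s = D / 2 * (h' - h) * (h_high \<delta> - h)"
    by (simp add: algebra_simps)
qed

text \<open>Since \<open>2 - 1 / (1 + l) = (2 * l + 1) / (1 + l)\<close>, this is the cubic divided
  by \<open>(1 + l)\<^sup>2\<close>: an affine function minus the square of a bounded increasing one
  for \<open>l \<ge> 0\<close>.\<close>

definition reduced_cubic :: "real \<Rightarrow> real \<Rightarrow> real \<Rightarrow> real" where
  "reduced_cubic h \<delta> l = ((\<delta>\<^sup>2 - 1) * h\<^sup>2 + 2 * h) * l + h - (2 - 1 / (1 + l))\<^sup>2"

lemma cubic_eq_reduced_cubic:
  assumes "l \<noteq> -1"
  shows "cubic h \<delta> l = (1 + l)\<^sup>2 * reduced_cubic h \<delta> l"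
proof -
  have nz: "1 + l \<noteq> 0" using assms by auto
  have "(1 + l) * (2 - 1 / (1 + l)) = 2 * (1 + l) - 1"
    using nz by (simp add: field_simps)
  then have "(1 + l)\<^sup>2 * (2 - 1 / (1 + l))\<^sup>2 = (2 * (1 + l) - 1)\<^sup>2"
    unfolding power_mult_distrib[symmetric] by (rule arg_cong)
  then have "(1 + l)\<^sup>2 * reduced_cubic h \<delta> l
      = (1 + l)\<^sup>2 * (((\<delta>\<^sup>2 - 1) * h\<^sup>2 + 2 * h) * l + h) - (2 * (1 + l) - 1)\<^sup>2"
    by (simp add: reduced_cubic_def right_diff_distrib)
  then show ?thesis
    by (simp add: cubic_def power2_eq_square power3_eq_cube algebra_simps)
qed

lemma finite_cubic_roots:
  assumes "(\<delta>\<^sup>2 - 1) * h\<^sup>2 + 2 * h \<noteq> 0"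
  shows "finite {l. cubic h \<delta> l = 0}"
proof -
  let ?p = "[:h - 1, (\<delta>\<^sup>2 - 1) * h\<^sup>2 + 4 * h - 4, 2 * (\<delta>\<^sup>2 - 1) * h\<^sup>2 + 5 * h - 4,
    (\<delta>\<^sup>2 - 1) * h\<^sup>2 + 2 * h:]"
  have "finite {l. poly ?p l = 0}"
    using assms by (intro poly_roots_finite) simp
  moreover have "cubic h \<delta> l = poly ?p l" for l
    by (simp add: cubic_def power2_eq_square power3_eq_cube algebra_simps)
  ultimately show ?thesis by simp
qed

text \<open>The middle regime in terms of \<open>s\<close>: \<open>1 / 2 \<le> s\<close> stands for
  \<open>h_low \<delta> \<le> h\<close>, \<open>s < 1\<close> for
  \<open>h < 2 / (1 + \<delta>)\<close>, and \<open>hs\<close> for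
  \<open>h \<le> h_high \<delta>\<close>.\<close>

locale middle_stepsize =
  fixes h \<delta> s :: real
  assumes \<delta>: "0 < \<delta>" "\<delta> < 1" and s_eq: "s = h * (1 + \<delta>) - 1"
    and s: "1 / 2 \<le> s" "s < 1" and hs: "h * s \<le> s\<^sup>2 - s + 1"
begin

lemma h_pos: "0 < h"
proof -
  have "0 < h * (1 + \<delta>)" using s s_eq by linarith
  then show ?thesis using \<delta> by (simp add: zero_less_mult_iff)
qed

text \<open>The bound \<open>h \<le> s + 1 / s - 1\<close> coming from \<open>hs\<close> is largest
  at \<open>s = 1 / 2\<close>.\<close>

lemma h_le: "h \<le> 3 / 2"
proof -
  have "0 \<le> (2 - s) * (s - 1 / 2)"
    using s by (intro mult_nonneg_nonneg) auto
  also have "\<dots> = 3 / 2 * s - (s\<^sup>2 - s + 1)"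
    by (simp add: power2_eq_square field_simps)
  finally have "h * s \<le> 3 / 2 * s" using hs by linarith
  then show ?thesis using s by simp
qed

lemma leading_eq: "(\<delta>\<^sup>2 - 1) * h\<^sup>2 + 2 * h = (1 + s)\<^sup>2 - 2 * s * h"
  by (simp add: s_eq power2_eq_square algebra_simps)

text \<open>The left side is the slope of \<open>(2 - 1 / (1 + l))\<^sup>2\<close> at
  \<open>l = 1 / s - 1\<close>, so there the affine part of \<open>reduced_cubic\<close> grows at
  least as fast as the subtracted square.\<close>

lemma leading_ge: "s\<^sup>2 * (4 - 2 * s) \<le> (\<delta>\<^sup>2 - 1) * h\<^sup>2 + 2 * h"
proof -
  have "0 \<le> (s - 1)\<^sup>2 * (2 * s - 1)" using s by simp
  also have "\<dots> = (1 + s)\<^sup>2 - 2 * (s\<^sup>2 - s + 1) - s\<^sup>2 * (4 - 2 * s)"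
    by (simp add: power2_eq_square algebra_simps)
  also have "\<dots> \<le> (1 + s)\<^sup>2 - 2 * (h * s) - s\<^sup>2 * (4 - 2 * s)"
    using hs by simp
  finally show ?thesis
    unfolding leading_eq by (simp add: ac_simps)
qed

text \<open>The mean slope \<open>v * w * (4 - v - w)\<close> of the subtracted square between
  \<open>x\<close> and \<open>y\<close> is below its slope \<open>v\<^sup>2 * (4 - 2 * v)\<close> at
  \<open>x\<close>. The latter increases with \<open>v \<le> s\<close>, hence is at most the slope
  at \<open>v = s\<close>, which \<open>leading_ge\<close> controls.\<close>

lemma reduced_cubic_strict_mono:
  assumes x: "1 / s - 1 \<le> x" and xy: "x < y"
  shows "reduced_cubic h \<delta> x < reduced_cubic h \<delta> y"
proof -
  define v w where "v = 1 / (1 + x)" and "w = 1 / (1 + y)"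
  define a where "a = (\<delta>\<^sup>2 - 1) * h\<^sup>2 + 2 * h"
  have "1 / s > 0" using s by simp
  then have pos: "0 < 1 + x" "0 < 1 + y" using x xy by linarith+
  have "1 / (1 + x) \<le> 1 / (1 / s)"
    using x \<open>1 / s > 0\<close> pos by (intro divide_left_mono) auto
  then have v: "0 < v" "v \<le> s" using pos by (simp_all add: v_def)
  have w: "0 < w" "w < v" using pos xy by (simp_all add: v_def w_def divide_strict_left_mono)
  have diff: "v - w = (y - x) * (v * w)"
    using pos by (simp add: v_def w_def field_simps)
  have "v * w * (4 - v - w) < v\<^sup>2 * (4 - 2 * v)"
  proof -
    have "0 < v * (v - w) * (4 - 2 * v - w)"
      using v w s by (intro mult_pos_pos) auto
    then show ?thesis by (simp add: power2_eq_square algebra_simps)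
  qed
  also have "\<dots> \<le> s\<^sup>2 * (4 - 2 * s)"
  proof -
    have "0 \<le> v * (2 - v - s) + s * (2 - s)"
      using v s by (intro add_nonneg_nonneg mult_nonneg_nonneg) auto
    then have "v\<^sup>2 + v * s + s\<^sup>2 \<le> 2 * (s + v)"
      by (simp add: power2_eq_square algebra_simps)
    then have "0 \<le> (s - v) * (4 * (s + v) - 2 * (v\<^sup>2 + v * s + s\<^sup>2))"
      using v s by (intro mult_nonneg_nonneg) auto
    also have "\<dots> = s\<^sup>2 * (4 - 2 * s) - v\<^sup>2 * (4 - 2 * v)"
      by (simp add: power2_eq_square algebra_simps)
    finally show ?thesis by simp
  qed
  also have "\<dots> \<le> a" unfolding a_def by (rule leading_ge)
  finally have "0 < (y - x) * (a - v * w * (4 - v - w))"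
    using xy by simp
  also have "\<dots> = a * (y - x) - (v - w) * (4 - v - w)"
    by (simp add: diff algebra_simps)
  also have "\<dots> = reduced_cubic h \<delta> y - reduced_cubic h \<delta> x"
    unfolding reduced_cubic_def a_def[symmetric] v_def[symmetric] w_def[symmetric]
    by (simp add: power2_eq_square algebra_simps)
  finally show ?thesis by simp
qed

text \<open>The residual that separates the middle from the long regime appears as a factor: where
  it vanishes, \<open>1 / s - 1\<close> is a root and the multipliers of both regimes meet.\<close>

lemma reduced_cubic_lower: "s * reduced_cubic h \<delta> (1 / s - 1) = (2 * s - 1) * (h * s - (s\<^sup>2 - s + 1))"
  unfolding reduced_cubic_def leading_eq using s by (simp add: power2_eq_square field_simps)

lemma reduced_cubic_lower_nonpos: "reduced_cubic h \<delta> (1 / s - 1) \<le> 0"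
proof -
  have "s * reduced_cubic h \<delta> (1 / s - 1) \<le> 0"
    unfolding reduced_cubic_lower using s hs by (intro mult_nonneg_nonpos) auto
  then show ?thesis using s by (simp add: mult_le_0_iff)
qed

lemma reduced_cubic_one_nonneg: "0 \<le> reduced_cubic h \<delta> 1"
proof -
  \<comment> \<open>Replacing \<open>h\<close> by its bound \<open>3 / 2\<close> turns the value at
    1 into \<open>(s - 1 / 2)\<^sup>2\<close>.\<close>
  have "(2 * s - 1) * h \<le> (2 * s - 1) * (3 / 2)"
    using s h_le by (intro mult_left_mono) auto
  moreover have "0 \<le> (s - 1 / 2)\<^sup>2" by simp
  ultimately show ?thesis
    unfolding reduced_cubic_def leading_eq by (simp add: power2_eq_square algebra_simps)
qed

text \<open>The intermediate value theorem gives a root in \<open>[1 / s - 1, 1]\<close>, and strict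
  monotonicity excludes larger ones. Finiteness of the root set is what lets \<open>Max\<close> pick
  this root.\<close>

lemma lam_properties:
  shows lam_ge: "1 / s - 1 \<le> lam h \<delta>" and lam_le: "lam h \<delta> \<le> 1"
    and reduced_cubic_lam: "reduced_cubic h \<delta> (lam h \<delta>) = 0"
proof -
  have beta: "0 < 1 / s - 1" "1 / s - 1 \<le> 1" using s by (simp_all add: field_simps)
  have "continuous_on {1 / s - 1..1} (reduced_cubic h \<delta>)"
    unfolding reduced_cubic_def using beta by (auto intro!: continuous_intros)
  then obtain r where r: "1 / s - 1 \<le> r" "r \<le> 1" "reduced_cubic h \<delta> r = 0"
    using IVT'[of "reduced_cubic h \<delta>" "1 / s - 1" 0 1] reduced_cubic_lower_nonpos
      reduced_cubic_one_nonneg beta by auto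
  have "0 < s\<^sup>2 * (4 - 2 * s)" using s by simp
  then have "(\<delta>\<^sup>2 - 1) * h\<^sup>2 + 2 * h \<noteq> 0" using leading_ge by linarith
  then have "finite {l. cubic h \<delta> l = 0}" by (rule finite_cubic_roots)
  moreover have "l \<le> r" if "cubic h \<delta> l = 0" for l
  proof (rule ccontr)
    assume "\<not> l \<le> r"
    then have "0 < reduced_cubic h \<delta> l" "l > 0"
      using reduced_cubic_strict_mono[of r l] r beta by auto
    then show False
      using that cubic_eq_reduced_cubic[of l h \<delta>] by auto
  qed
  moreover have "cubic h \<delta> r = 0"
    using r beta cubic_eq_reduced_cubic[of r h \<delta>] by auto
  ultimately have "lam h \<delta> = r"
    unfolding lam_def by (intro Max_eqI) auto
  with r show "1 / s - 1 \<le> lam h \<delta>" "lam h \<delta> \<le> 1" "reduced_cubic h \<delta> (lam h \<delta>) = 0"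
    by auto
qed

lemma lam_pos: "0 < lam h \<delta>"
proof -
  have "0 < 1 / s - 1" using s by (simp add: field_simps)
  then show ?thesis using lam_ge by linarith
qed

text \<open>This and \<open>lam_less\<close> locate the root by the sign at a fixed point, which
  turns continuity of \<open>reduced_cubic\<close> in the parameters into continuity of
  \<open>lam\<close>.\<close>

lemma less_lam:
  assumes "reduced_cubic h \<delta> a < 0"
  shows "a < lam h \<delta>"
proof (rule ccontr)
  assume "\<not> a < lam h \<delta>"
  then have "reduced_cubic h \<delta> (lam h \<delta>) \<le> reduced_cubic h \<delta> a"
    using reduced_cubic_strict_mono[OF lam_ge, of a] by (cases "a = lam h \<delta>") auto
  then show False using assms reduced_cubic_lam by simp
qed

lemma lam_less:
  assumes "1 / s - 1 \<le> a" "0 < reduced_cubic h \<delta> a"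
  shows "lam h \<delta> < a"
proof (rule ccontr)
  assume "\<not> lam h \<delta> < a"
  then have "reduced_cubic h \<delta> a \<le> reduced_cubic h \<delta> (lam h \<delta>)"
    using reduced_cubic_strict_mono[OF assms(1), of "lam h \<delta>"] by (cases "a = lam h \<delta>") auto
  then show False using assms reduced_cubic_lam by simp
qed

lemma lam_equation:
  "(2 * lam h \<delta> + 1)\<^sup>2 = (((\<delta>\<^sup>2 - 1) * h\<^sup>2 + 2 * h) * lam h \<delta> + h) * (1 + lam h \<delta>)\<^sup>2"
proof -
  have "(2 - 1 / (1 + lam h \<delta>)) * (1 + lam h \<delta>) = 2 * lam h \<delta> + 1"
    using lam_pos by (simp add: field_simps)
  then have "(2 * lam h \<delta> + 1)\<^sup>2 = (2 - 1 / (1 + lam h \<delta>))\<^sup>2 * (1 + lam h \<delta>)\<^sup>2"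
    by (metis power_mult_distrib)
  then show ?thesis
    using reduced_cubic_lam by (simp add: reduced_cubic_def)
qed

text \<open>The first factor increases in \<open>l\<close> because \<open>h < 2\<close>, and at
  \<open>l = 1 / s - 1\<close> it is \<open>(2 - s - h) / s\<close>. The second exceeds it by
  \<open>h * (1 + l) * (1 - l)\<close>, nonnegative as \<open>l \<le> 1\<close>.\<close>

lemma factors_nonneg:
  defines "l \<equiv> lam h \<delta>"
  shows "0 \<le> 2 * l + 1 - h * (1 + l)" "0 \<le> 2 * l + 1 - l * h * (1 + l)"
proof -
  have "0 \<le> (2 * s - 1) * (1 - s)"
    using s by (intro mult_nonneg_nonneg) auto
  also have "\<dots> \<le> s * (2 - s - h)"
    using hs by (simp add: power2_eq_square algebra_simps)
  finally have "0 \<le> 2 - s - h" using s by (simp add: zero_le_mult_iff)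
  then have "0 \<le> (2 - s - h) / s" using s by simp
  also have "\<dots> = (2 - h) * (1 / s - 1) + 1 - h" using s by (simp add: field_simps)
  also have "\<dots> \<le> (2 - h) * l + 1 - h"
    using h_le lam_ge unfolding l_def
    by (intro diff_right_mono add_right_mono mult_left_mono) auto
  finally show A: "0 \<le> 2 * l + 1 - h * (1 + l)"
    by (simp add: algebra_simps)
  have "0 \<le> h * (1 + l) * (1 - l)"
    using h_pos lam_pos lam_le by (simp add: l_def)
  then show "0 \<le> 2 * l + 1 - l * h * (1 + l)"
    using A by (simp add: algebra_simps)
qed

lemma factors_mult:
  defines "l \<equiv> lam h \<delta>"
  shows "(2 * l + 1 - h * (1 + l)) * (2 * l + 1 - l * h * (1 + l)) = l * (h * \<delta> * (1 + l))\<^sup>2"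
proof -
  have "(2 * l + 1 - h * (1 + l)) * (2 * l + 1 - l * h * (1 + l))
      = (2 * l + 1)\<^sup>2 - (2 * l + 1) * h * (1 + l)\<^sup>2 + l * h\<^sup>2 * (1 + l)\<^sup>2"
    by (simp add: power2_eq_square algebra_simps)
  also have "\<dots> = l * (h * \<delta> * (1 + l))\<^sup>2"
    unfolding l_def lam_equation by (simp add: power2_eq_square algebra_simps)
  finally show ?thesis .
qed

text \<open>By the cubic equation, \<open>2 * l + 1\<close> times this denominator is
  \<open>l * h\<^sup>2 * (1 - \<delta>\<^sup>2) * (1 + l)\<^sup>2\<close>.\<close>

lemma denominator_pos:
  defines "l \<equiv> lam h \<delta>"
  shows "0 < h * l\<^sup>2 + 2 * (h - 1) * l + h - 1"
proof -
  have l: "0 < l" using lam_pos by (simp add: l_def)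
  have "\<delta>\<^sup>2 < 1" using \<delta> by (simp add: power_less_one_iff)
  then have "0 < l * h\<^sup>2 * (1 - \<delta>\<^sup>2) * (1 + l)\<^sup>2"
    using l h_pos by simp
  also have "\<dots> = (2 * l + 1) * h * (1 + l)\<^sup>2 - (2 * l + 1)\<^sup>2"
    unfolding l_def lam_equation by (simp add: power2_eq_square algebra_simps)
  also have "\<dots> = (2 * l + 1) * (h * l\<^sup>2 + 2 * (h - 1) * l + h - 1)"
    by (simp add: power2_eq_square algebra_simps)
  finally show ?thesis using l by (simp add: zero_less_mult_iff)
qed

end

subsection \<open>The rate as a function of the parameters\<close>

lemma h_low_bounds:
  assumes "0 < \<delta>"
  shows "h_low \<delta> < 3 / 2" "h_low \<delta> * (1 + \<delta>) = 3 / 2"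
  using assms by (simp_all add: h_low_def field_simps)

text \<open>At \<open>h_low \<delta>\<close> one has \<open>s = 1 / 2\<close>, and the residual
  \<open>3 / 4 - h_low \<delta> / 2\<close> is positive.\<close>

lemma h_low_le_h_high:
  assumes \<delta>: "0 < \<delta>" "\<delta> < 1"
  shows "h_low \<delta> \<le> h_high \<delta>"
proof -
  note low = h_low_bounds[OF \<delta>(1)]
  have "h_low \<delta> \<le> 2 / (1 + \<delta>)" using \<delta> by (simp add: h_low_def field_simps)
  then obtain c where "c > 0" "(1 / 2)\<^sup>2 - 1 / 2 + 1 - h_low \<delta> * (1 / 2) = c * (h_high \<delta> - h_low \<delta>)"
    using h_high_residual[OF \<delta>, of "h_low \<delta>" "1 / 2"] low by auto
  moreover have "0 < (1 / 2)\<^sup>2 - 1 / 2 + 1 - h_low \<delta> * (1 / 2)"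
    using low by (simp add: power2_eq_square)
  ultimately show ?thesis
    by (simp add: zero_less_mult_iff)
qed

text \<open>At \<open>h = 2 / (1 + \<delta>)\<close> one has \<open>s = 1\<close>, and the residual
  \<open>1 - h\<close> is negative.\<close>

lemma h_high_less:
  assumes \<delta>: "0 < \<delta>" "\<delta> < 1"
  shows "h_high \<delta> < 2 / (1 + \<delta>)"
proof -
  have "1 < 2 / (1 + \<delta>)" using \<delta> by simp
  moreover have "1 = 2 / (1 + \<delta>) * (1 + \<delta>) - 1" using \<delta> by (simp add: field_simps)
  from h_high_residual[OF \<delta> order_refl this] obtain c
    where "c > 0" "1\<^sup>2 - 1 + 1 - 2 / (1 + \<delta>) * 1 = c * (h_high \<delta> - 2 / (1 + \<delta>))" .
  ultimately have "c * (h_high \<delta> - 2 / (1 + \<delta>)) < 0" by simp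
  with \<open>c > 0\<close> show ?thesis by (simp add: mult_less_0_iff)
qed

lemma middle_stepsizeI:
  assumes \<delta>: "0 < \<delta>" "\<delta> < 1" and h: "h_low \<delta> \<le> h" "h \<le> h_high \<delta>"
  shows "middle_stepsize h \<delta> (h * (1 + \<delta>) - 1)"
proof
  have h2: "h < 2 / (1 + \<delta>)" using h h_high_less[OF \<delta>] by linarith
  then show "h * (1 + \<delta>) - 1 < 1" using \<delta> by (simp add: field_simps)
  show "1 / 2 \<le> h * (1 + \<delta>) - 1"
    using mult_right_mono[OF h(1), of "1 + \<delta>"] \<delta> h_low_bounds[OF \<delta>(1)] by simp
  obtain c where "c > 0" "(h * (1 + \<delta>) - 1)\<^sup>2 - (h * (1 + \<delta>) - 1) + 1 - h * (h * (1 + \<delta>) - 1)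
      = c * (h_high \<delta> - h)"
    using h_high_residual[OF \<delta>, of h "h * (1 + \<delta>) - 1"] h2 by auto
  moreover have "0 \<le> c * (h_high \<delta> - h)" using \<open>c > 0\<close> h by simp
  ultimately show "h * (h * (1 + \<delta>) - 1) \<le> (h * (1 + \<delta>) - 1)\<^sup>2 - (h * (1 + \<delta>) - 1) + 1"
    by linarith
qed (use \<delta> in auto)

lemma long_stepsize:
  assumes \<delta>: "0 < \<delta>" "\<delta> < 1" and h: "h_high \<delta> \<le> h" "h \<le> 2 / (1 + \<delta>)"
    and s: "s = h * (1 + \<delta>) - 1"
  shows "1 / 2 \<le> s" "s \<le> 1" "s\<^sup>2 - s + 1 \<le> h * s"
proof -
  show "s \<le> 1" using h \<delta> by (simp add: s field_simps)
  have "h_low \<delta> \<le> h" using h h_low_le_h_high[OF \<delta>] by linarith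
  from mult_right_mono[OF this, of "1 + \<delta>"] show "1 / 2 \<le> s"
    using \<delta> h_low_bounds[OF \<delta>(1)] by (simp add: s)
  obtain c where "c > 0" "s\<^sup>2 - s + 1 - h * s = c * (h_high \<delta> - h)"
    using h_high_residual[OF \<delta> h(2) s] .
  moreover have "c * (h_high \<delta> - h) \<le> 0"
    using \<open>c > 0\<close> h by (simp add: mult_le_0_iff)
  ultimately show "s\<^sup>2 - s + 1 \<le> h * s" by linarith
qed

section \<open>The reciprocal rate: values at the thresholds, continuity and sign\<close>

definition middle_rate :: "real \<Rightarrow> real \<Rightarrow> real" where
  "middle_rate h \<delta> = (h * (lam h \<delta>)\<^sup>2 + 2 * (h - 1) * lam h \<delta> + h - 1) / (2 * lam h \<delta>)"

text \<open>The reciprocal of \<open>C_step\<close>, which stays finite where \<open>C_step\<close> is infinite.\<close>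

definition step_rate :: "real \<Rightarrow> real \<Rightarrow> real" where
  "step_rate h \<delta> =
     (if h \<le> h_low \<delta> then h * (1 - \<delta>)
      else if h \<le> h_high \<delta> then middle_rate h \<delta>
      else (1 / (h * (1 + \<delta>) - 1)\<^sup>2 - 1) / 2)"

text \<open>Here \<open>s = 1 / 2\<close>, so the interval \<open>[1 / s - 1, 1]\<close> containing
  the root shrinks to the point 1.\<close>

lemma middle_rate_at_h_low:
  assumes \<delta>: "0 < \<delta>" "\<delta> < 1"
  shows "middle_rate (h_low \<delta>) \<delta> = h_low \<delta> * (1 - \<delta>)"
proof -
  note low = h_low_bounds[OF \<delta>(1)]
  interpret middle_stepsize "h_low \<delta>" \<delta> "h_low \<delta> * (1 + \<delta>) - 1"
    by (rule middle_stepsizeI[OF \<delta> order_refl h_low_le_h_high[OF \<delta>]])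
  have "lam (h_low \<delta>) \<delta> = 1"
    using lam_ge lam_le by (simp add: low)
  then show ?thesis
    using low(2) by (simp add: middle_rate_def field_simps)
qed

text \<open>The inequalities of both adjacent regimes hold at the threshold, which forces
  \<open>h * s = s\<^sup>2 - s + 1\<close> and hence
  \<open>lam h \<delta> = 1 / s - 1\<close>.\<close>

lemma middle_rate_at_h_high:
  assumes \<delta>: "0 < \<delta>" "\<delta> < 1"
  shows "middle_rate (h_high \<delta>) \<delta> = (1 / (h_high \<delta> * (1 + \<delta>) - 1)\<^sup>2 - 1) / 2"
proof -
  define h s where "h = h_high \<delta>" and "s = h * (1 + \<delta>) - 1"
  interpret middle_stepsize h \<delta> s
    unfolding h_def s_def by (rule middle_stepsizeI[OF \<delta> h_low_le_h_high[OF \<delta>] order_refl])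
  have "s\<^sup>2 - s + 1 \<le> h * s"
    by (rule long_stepsize[OF \<delta> _ _ s_def]) (use h_high_less[OF \<delta>] in \<open>auto simp: h_def\<close>)
  with hs have hs': "h * s = s\<^sup>2 - s + 1" by simp
  have "reduced_cubic h \<delta> (1 / s - 1) = 0"
    using reduced_cubic_lower s hs' by simp
  then have "lam h \<delta> = 1 / s - 1"
    using reduced_cubic_strict_mono[of "1 / s - 1" "lam h \<delta>"] lam_ge reduced_cubic_lam by fastforce
  moreover have "(h * (1 / s - 1)\<^sup>2 + 2 * (h - 1) * (1 / s - 1) + h - 1) / (2 * (1 / s - 1))
      = (1 / s\<^sup>2 - 1) / 2"
  proof -
    define b where "b = 1 / s - 1"
    have b: "b > 0" using s by (simp add: b_def)
    have sb: "s = 1 / (1 + b)" using s by (simp add: b_def)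
    have "h * (1 + b)\<^sup>2 = (h * s) * (1 + b) ^ 3"
      using b by (simp add: sb power2_eq_square power3_eq_cube)
    also have "\<dots> = ((s * (1 + b))\<^sup>2 - s * (1 + b) * (1 + b) + (1 + b)\<^sup>2) * (1 + b)"
      unfolding hs' by (simp add: power2_eq_square power3_eq_cube algebra_simps)
    also have "s * (1 + b) = 1" using b by (simp add: sb)
    finally have "h * b\<^sup>2 + 2 * (h - 1) * b + h - 1 = (2 * b) * (((1 + b)\<^sup>2 - 1) / 2)"
      by (simp add: power2_eq_square field_simps)
    moreover have "1 / s\<^sup>2 = (1 + b)\<^sup>2" using b by (simp add: sb power_divide)
    ultimately show ?thesis
      unfolding b_def[symmetric] using b by simp
  qed
  ultimately show ?thesis
    by (simp add: middle_rate_def h_def[symmetric] s_def[symmetric])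
qed

text \<open>Each strict bound on \<open>lam\<close> at \<open>p\<close> is witnessed by strict
  inequalities on the continuous functions \<open>reduced_cubic\<close> and \<beta>, and these
  persist near \<open>p\<close>.\<close>

lemma continuous_on_lam:
  "continuous_on {p. 0 < snd p \<and> snd p < 1 \<and> h_low (snd p) \<le> fst p \<and> fst p \<le> h_high (snd p)}
     (\<lambda>p. lam (fst p) (snd p))" (is "continuous_on ?M _")
proof -
  define \<beta> :: "real \<times> real \<Rightarrow> real" where "\<beta> p = 1 / (fst p * (1 + snd p) - 1) - 1" for p
  have mid: "middle_stepsize (fst p) (snd p) (fst p * (1 + snd p) - 1)" if "p \<in> ?M" for p
    using that by (auto intro: middle_stepsizeI)
  have \<beta>_le: "\<beta> p \<le> lam (fst p) (snd p)" and \<beta>_pos: "0 < \<beta> p"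
    and nz: "fst p * (1 + snd p) - 1 \<noteq> 0" if "p \<in> ?M" for p
    using middle_stepsize.lam_ge[OF mid[OF that]] middle_stepsize.s[OF mid[OF that]]
    by (auto simp: \<beta>_def)
  have \<beta>: "(\<beta> \<longlongrightarrow> \<beta> p) (at p within ?M)" if "p \<in> ?M" for p
    unfolding \<beta>_def using nz[OF that] by (auto intro!: tendsto_intros)
  have rc: "((\<lambda>q. reduced_cubic (fst q) (snd q) a) \<longlongrightarrow> reduced_cubic (fst p) (snd p) a)
      (at p within ?M)" for a p
    unfolding reduced_cubic_def by (intro tendsto_intros)
  have inM: "\<forall>\<^sub>F q in at p within ?M. q \<in> ?M" for p
    by (simp add: eventually_at_filter)
  show ?thesis
    unfolding continuous_on_def
  proof (intro ballI order_tendstoI)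
    fix p a assume p: "p \<in> ?M" and a: "a < lam (fst p) (snd p)"
    show "\<forall>\<^sub>F q in at p within ?M. a < lam (fst q) (snd q)"
    \<comment> \<open>Monotonicity is available only from \<open>\<beta> p\<close> on; below it, the
      continuous lower bound \<beta> of \<open>lam\<close> already separates.\<close>
    proof (cases "a < \<beta> p")
      case True
      from order_tendstoD(1)[OF \<beta>[OF p] this] inM show ?thesis
        by eventually_elim (use \<beta>_le in force)
    next
      case False
      interpret middle_stepsize "fst p" "snd p" "fst p * (1 + snd p) - 1" by (rule mid[OF p])
      have "reduced_cubic (fst p) (snd p) a < 0"
        using reduced_cubic_strict_mono[OF _ a] False reduced_cubic_lam by (simp add: \<beta>_def)
      from order_tendstoD(2)[OF rc this] inM show ?thesis
        by eventually_elim (rule middle_stepsize.less_lam[OF mid])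
    qed
  next
    fix p a assume p: "p \<in> ?M" and a: "lam (fst p) (snd p) < a"
    interpret middle_stepsize "fst p" "snd p" "fst p * (1 + snd p) - 1" by (rule mid[OF p])
    have "0 < reduced_cubic (fst p) (snd p) a"
      using reduced_cubic_strict_mono[OF lam_ge a] reduced_cubic_lam by simp
    moreover have "\<beta> p < a" using \<beta>_le[OF p] a by linarith
    ultimately have "\<forall>\<^sub>F q in at p within ?M. 0 < reduced_cubic (fst q) (snd q) a"
      and "\<forall>\<^sub>F q in at p within ?M. \<beta> q < a"
      using order_tendstoD(1)[OF rc] order_tendstoD(2)[OF \<beta>[OF p]] by auto
    with inM[of p] show "\<forall>\<^sub>F q in at p within ?M. lam (fst q) (snd q) < a"
      by eventually_elim (rule middle_stepsize.lam_less[OF mid], auto simp: \<beta>_def)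
  qed
qed

text \<open>The three branches are continuous on relatively closed pieces and agree at both
  thresholds, so they glue.\<close>

lemma continuous_on_step_rate: "continuous_on params (\<lambda>p. step_rate (fst p) (snd p))"
proof -
  have \<delta>: "0 < snd p" "snd p < 1" if "p \<in> params" for p
    using that by (auto simp: params_def)
  have low: "continuous_on params (\<lambda>p. h_low (snd p))"
    unfolding h_low_def using \<delta> by (fastforce intro!: continuous_intros)
  have high: "continuous_on params (\<lambda>p. h_high (snd p))"
    unfolding h_high_def using \<delta> by (fastforce intro!: continuous_intros)
  let ?S = "{p \<in> params. 0 \<le> fst p - h_low (snd p)}"
  have "continuous_on {p \<in> ?S. fst p - h_high (snd p) \<le> 0} (\<lambda>p. middle_rate (fst p) (snd p))"
  proof -
    have lam: "continuous_on {p \<in> ?S. fst p - h_high (snd p) \<le> 0} (\<lambda>p. lam (fst p) (snd p))"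
      by (rule continuous_on_subset[OF continuous_on_lam]) (auto simp: params_def)
    have "lam (fst p) (snd p) \<noteq> 0" if "p \<in> {p \<in> ?S. fst p - h_high (snd p) \<le> 0}" for p
      using middle_stepsize.lam_pos[OF middle_stepsizeI, of "snd p" "fst p"] that \<delta>[of p] by force
    then show ?thesis
      unfolding middle_rate_def by (intro continuous_intros lam) auto
  qed
  moreover have "continuous_on {p \<in> ?S. 0 \<le> fst p - h_high (snd p)}
      (\<lambda>p. (1 / (fst p * (1 + snd p) - 1)\<^sup>2 - 1) / 2)"
  proof -
    have "fst p * (1 + snd p) - 1 \<noteq> 0" if "p \<in> {p \<in> ?S. 0 \<le> fst p - h_high (snd p)}" for p
      using long_stepsize(1)[OF _ _ _ _ refl, of "snd p" "fst p"] that by (auto simp: params_def)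
    then show ?thesis by (intro continuous_intros) auto
  qed
  ultimately have "continuous_on ?S (\<lambda>p. if fst p - h_high (snd p) \<le> 0 then middle_rate (fst p) (snd p)
      else (1 / (fst p * (1 + snd p) - 1)\<^sup>2 - 1) / 2)"
  proof (rule continuous_on_cases_le)
    show "continuous_on ?S (\<lambda>p. fst p - h_high (snd p))"
      by (intro continuous_intros continuous_on_subset[OF high]) auto
    show "middle_rate (fst p) (snd p) = (1 / (fst p * (1 + snd p) - 1)\<^sup>2 - 1) / 2"
      if "p \<in> ?S" "fst p - h_high (snd p) = 0" for p
      using middle_rate_at_h_high[of "snd p"] that \<delta>[of p] by simp
  qed
  moreover have "continuous_on {p \<in> params. fst p - h_low (snd p) \<le> 0} (\<lambda>p. fst p * (1 - snd p))"
    by (intro continuous_intros)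
  ultimately have "continuous_on params (\<lambda>p. if fst p - h_low (snd p) \<le> 0 then fst p * (1 - snd p)
      else if fst p - h_high (snd p) \<le> 0 then middle_rate (fst p) (snd p)
      else (1 / (fst p * (1 + snd p) - 1)\<^sup>2 - 1) / 2)"
  proof (intro continuous_on_cases_le[where h = "\<lambda>p. fst p - h_low (snd p)"])
    show "continuous_on params (\<lambda>p. fst p - h_low (snd p))"
      by (intro continuous_intros low)
    show "fst p * (1 - snd p) = (if fst p - h_high (snd p) \<le> 0 then middle_rate (fst p) (snd p)
      else (1 / (fst p * (1 + snd p) - 1)\<^sup>2 - 1) / 2)"
      if "p \<in> params" "fst p - h_low (snd p) = 0" for p
      using middle_rate_at_h_low[of "snd p"] h_low_le_h_high[of "snd p"] that \<delta>[of p] by simp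
  qed
  then show ?thesis
    by (simp add: step_rate_def cong: if_cong)
qed

text \<open>The sign matters for passing to reciprocals: inversion of \<open>ereal\<close> is
  continuous on \<open>[0, \<infinity>]\<close>, including 0.\<close>

lemma step_rate_nonneg:
  assumes \<delta>: "0 < \<delta>" "\<delta> < 1" and h: "0 \<le> h" "h \<le> 2 / (1 + \<delta>)"
  shows "0 \<le> step_rate h \<delta>"
proof -
  consider "h \<le> h_low \<delta>" | "h_low \<delta> < h" "h \<le> h_high \<delta>" | "h_low \<delta> < h" "h_high \<delta> < h"
    by linarith
  then show ?thesis
  proof cases
    case 1
    then show ?thesis using \<delta> h by (simp add: step_rate_def)
  next
    case 2
    then interpret middle_stepsize h \<delta> "h * (1 + \<delta>) - 1"
      using \<delta> by (intro middle_stepsizeI) auto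
    show ?thesis
      using 2 denominator_pos lam_pos by (simp add: step_rate_def middle_rate_def)
  next
    case 3
    have "1 / 2 \<le> h * (1 + \<delta>) - 1" "h * (1 + \<delta>) - 1 \<le> 1"
      using long_stepsize[OF \<delta> _ h(2) refl] 3 by auto
    then have "(h * (1 + \<delta>) - 1)\<^sup>2 \<le> 1" "0 < (h * (1 + \<delta>) - 1)\<^sup>2"
      by (auto intro!: power_le_one)
    then show ?thesis
      using 3 by (simp add: step_rate_def)
  qed
qed

section \<open>From the reciprocal rate to the two constants and the estimates\<close>

lemma C_step_eq_step_rate:
  assumes \<delta>: "0 < \<delta>" "\<delta> < 1" and h: "0 \<le> h" "h \<le> 2 / (1 + \<delta>)"
  shows "C_step h \<delta> = inverse (ereal (step_rate h \<delta>))"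
proof -
  have one: "1 / ereal x = inverse (ereal x)" for x
    by (simp add: divide_ereal_def)
  consider "h < h_low \<delta>" | "h_low \<delta> \<le> h" "h \<le> h_high \<delta>" | "h_low \<delta> \<le> h" "h_high \<delta> < h"
    by linarith
  then show ?thesis
  proof cases
    case 1
    then show ?thesis by (simp only: C_step_def step_rate_def one if_True less_imp_le)
  next
    case 2
    then interpret middle_stepsize h \<delta> "h * (1 + \<delta>) - 1"
      using \<delta> by (intro middle_stepsizeI) auto
    \<comment> \<open>At \<open>h = h_low \<delta>\<close>, \<open>C_step\<close> takes its middle
      branch but \<open>step_rate\<close> its first; the values coincide.\<close>
    have rate: "step_rate h \<delta> = middle_rate h \<delta>"
      using 2 middle_rate_at_h_low[OF \<delta>] by (auto simp: step_rate_def)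
    have "middle_rate h \<delta> > 0"
      using denominator_pos lam_pos by (simp add: middle_rate_def)
    then show ?thesis
      using 2 by (simp add: C_step_def rate) (simp add: middle_rate_def)
  next
    case 3
    define x where "x = 1 / (h * (1 + \<delta>) - 1)\<^sup>2 - 1"
    have "(1 - h * (1 + \<delta>)) powi (-2) = 1 / (h * (1 + \<delta>) - 1)\<^sup>2"
      by (simp add: power_int_minus inverse_eq_divide power2_commute)
    then have "C_step h \<delta> = 2 / ereal x"
      using 3 by (simp add: C_step_def x_def)
    moreover have "step_rate h \<delta> = x / 2"
      using 3 h_low_le_h_high[OF \<delta>] by (simp add: step_rate_def x_def)
    \<comment> \<open>For \<open>x = 0\<close>, reached at \<open>h = 2 / (1 + \<delta>)\<close>,
      both sides are infinite.\<close>
    moreover have "2 / ereal x = inverse (ereal (x / 2))"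
    proof (cases "x = 0")
      case False
      have "2 / ereal x = ereal 2 / ereal x" by simp
      also have "\<dots> = inverse (ereal (x / 2))"
        using False by (subst ereal_divide) (simp_all add: inverse_eq_divide)
      finally show ?thesis .
    qed (simp add: divide_ereal_def)
    ultimately show ?thesis by (simp only:)
  qed
qed

lemma C_min_eq_step_rate:
  assumes \<delta>: "0 < \<delta>" "\<delta> < 1" and h: "0 \<le> h" "h \<le> 2 / (1 + \<delta>)"
  shows "C_min h \<delta> = 1 / (step_rate h \<delta> + 1 / 2)"
proof -
  consider "h < h_low \<delta>" | "h_low \<delta> \<le> h" "h \<le> h_high \<delta>" | "h_low \<delta> \<le> h" "h_high \<delta> < h"
    by linarith
  then show ?thesis
  proof cases
    case 1
    then show ?thesis by (simp add: C_min_def step_rate_def)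
  next
    case 2
    then interpret middle_stepsize h \<delta> "h * (1 + \<delta>) - 1"
      using \<delta> by (intro middle_stepsizeI) auto
    have "step_rate h \<delta> = middle_rate h \<delta>"
      using 2 middle_rate_at_h_low[OF \<delta>] by (auto simp: step_rate_def)
    then have "step_rate h \<delta> + 1 / 2
        = (h * (lam h \<delta>)\<^sup>2 + (2 * h - 1) * lam h \<delta> + h - 1) / (2 * lam h \<delta>)"
      using lam_pos by (simp add: middle_rate_def field_simps)
    then show ?thesis
      using 2 by (simp add: C_min_def)
  next
    case 3
    then have "step_rate h \<delta> + 1 / 2 = 1 / (2 * (h * (1 + \<delta>) - 1)\<^sup>2)"
      using h_low_le_h_high[OF \<delta>] by (simp add: step_rate_def diff_divide_distrib)
    then show ?thesis
      using 3 by (simp add: C_min_def power2_commute)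
  qed
qed

lemma inexact_gd_step_rate:
  assumes smooth: "L_smooth L f" and cvx: "convex_on UNIV f" and L: "L > 0"
    and step: "inexact_gd_step L h \<delta> f x0 x1"
    and \<delta>: "0 < \<delta>" "\<delta> < 1" and h: "0 \<le> h" "h \<le> 2 / (1 + \<delta>)"
  shows "step_rate h \<delta> / L * (norm (gradient f x1))\<^sup>2 \<le> f x0 - f x1"
proof -
  note decrease = inexact_gd_step_decrease[OF smooth cvx L step h(1)]
  consider "h \<le> h_low \<delta>" | "h_low \<delta> < h" "h \<le> h_high \<delta>" | "h_low \<delta> < h" "h_high \<delta> < h"
    by linarith
  then show ?thesis
  proof cases
    case 1
    have "h * (1 + \<delta>) \<le> 3 / 2"
      using mult_right_mono[OF 1, of "1 + \<delta>"] \<delta> h_low_bounds[OF \<delta>(1)] by simp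
    then have "h * (1 - \<delta>) / L * (norm (gradient f x1))\<^sup>2 \<le> f x0 - f x1"
      using \<delta> h by (intro decrease[of 1] short_step_form) auto
    then show ?thesis using 1 by (simp add: step_rate_def)
  next
    case 2
    then interpret middle_stepsize h \<delta> "h * (1 + \<delta>) - 1"
      using \<delta> by (intro middle_stepsizeI) auto
    have "2 * lam h \<delta> * middle_rate h \<delta> = h * (1 + lam h \<delta>)\<^sup>2 - (1 + 2 * lam h \<delta>)"
      using lam_pos unfolding middle_rate_def by simp (simp add: power2_eq_square algebra_simps)
    then have "middle_rate h \<delta> / L * (norm (gradient f x1))\<^sup>2 \<le> f x0 - f x1"
      using lam_pos factors_nonneg factors_mult
      by (intro decrease[of "lam h \<delta>"] middle_step_form) auto
    then show ?thesis using 2 by (simp add: step_rate_def)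
  next
    case 3
    define s where "s = h * (1 + \<delta>) - 1"
    have s: "1 / 2 \<le> s" "s \<le> 1" "s\<^sup>2 - s + 1 \<le> h * s"
      using long_stepsize[OF \<delta> _ h(2) s_def] 3 by auto
    then have "0 \<le> 1 / s - 1" by simp
    then have "(1 / s\<^sup>2 - 1) / 2 / L * (norm (gradient f x1))\<^sup>2 \<le> f x0 - f x1"
      using s by (intro decrease[of "1 / s - 1"] long_step_form[OF s_def]) auto
    then show ?thesis using 3 by (simp add: step_rate_def s_def)
  qed
qed

theorem theorem2p3:
  fixes f :: "real ^ 'n \<Rightarrow> real"
    and L \<delta> h :: real
    and x0 x1 xs :: "real ^ 'n"
  assumes "L > 0"
    and "convex_on UNIV f"
    and "L_smooth L f"
    and "\<forall>y. f xs \<le> f y"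
    and "0 < \<delta>" and "\<delta> < 1"
    and "0 \<le> h" and "h \<le> 2 / (1 + \<delta>)"
    and "inexact_gd_step L h \<delta> f x0 x1"
  shows "(if C_step h \<delta> = \<infinity> then f x1 \<le> f x0
          else ereal ((1 / L) * (norm (gradient f x1))^2) \<le> C_step h \<delta> * ereal (f x0 - f x1))
    \<and> (1 / L) * (norm (gradient f x1))^2 \<le> C_min h \<delta> * (f x0 - f xs)
    \<and> continuous_on params (\<lambda>(h, \<delta>). C_step h \<delta>)
    \<and> continuous_on params (\<lambda>(h, \<delta>). C_min h \<delta>)"
proof (intro conjI)
  define K where "K = step_rate h \<delta>"
  define G where "G = (1 / L) * (norm (gradient f x1))\<^sup>2"
  have K: "0 \<le> K"
    unfolding K_def using assms(5-8) by (rule step_rate_nonneg)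
  have rate: "K * G \<le> f x0 - f x1"
    using inexact_gd_step_rate[OF assms(3,2,1,9,5-8)] by (simp add: K_def G_def)
  have C_step: "C_step h \<delta> = inverse (ereal K)"
    unfolding K_def using assms(5-8) by (rule C_step_eq_step_rate)
  show "if C_step h \<delta> = \<infinity> then f x1 \<le> f x0
      else ereal ((1 / L) * (norm (gradient f x1))^2) \<le> C_step h \<delta> * ereal (f x0 - f x1)"
  proof (cases "K = 0")
    \<comment> \<open>A vanishing rate is the case \<open>C_step h \<delta> = \<infinity>\<close>,
      and \<open>rate\<close> then reads \<open>0 \<le> f x0 - f x1\<close>.\<close>
    case True
    then show ?thesis using rate C_step by simp
  next
    case False
    then have "K > 0" using K by simp
    then have "G \<le> inverse K * (f x0 - f x1)"
      using rate by (simp add: field_simps)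
    then show ?thesis
      using \<open>K > 0\<close> by (simp add: C_step G_def)
  qed
  \<comment> \<open>An exact gradient step of length \<open>1 / L\<close> from \<open>x1\<close>
    cannot get below the minimum.\<close>
  have "f xs \<le> f x1 - G / 2"
    using gradient_step_decrease[OF assms(3,1), of x1] assms(4)[rule_format, of "x1 - (1 / L) *\<^sub>R gradient f x1"]
    by (simp add: G_def)
  with rate have "(K + 1 / 2) * G \<le> f x0 - f xs"
    by (simp add: algebra_simps)
  then have "G \<le> 1 / (K + 1 / 2) * (f x0 - f xs)"
    using K by (simp add: field_simps)
  then show "(1 / L) * (norm (gradient f x1))^2 \<le> C_min h \<delta> * (f x0 - f xs)"
    using C_min_eq_step_rate[OF assms(5-8)] by (simp add: G_def K_def)
next
  have nonneg: "0 \<le> step_rate h \<delta>" if "(h, \<delta>) \<in> params" for h \<delta>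
    using that by (auto simp: params_def intro: step_rate_nonneg)
  have "continuous_on params (\<lambda>p. inverse (ereal (step_rate (fst p) (snd p))))"
    by (rule continuous_on_compose2[OF continuous_on_inverse_ereal])
      (auto intro!: continuous_on_ereal continuous_on_step_rate simp: nonneg)
  then show "continuous_on params (\<lambda>(h, \<delta>). C_step h \<delta>)"
    by (rule continuous_on_eq) (auto simp: params_def C_step_eq_step_rate)
  have "continuous_on params (\<lambda>p. 1 / (step_rate (fst p) (snd p) + 1 / 2))"
    by (intro continuous_intros continuous_on_step_rate) (use nonneg in fastforce)
  then show "continuous_on params (\<lambda>(h, \<delta>). C_min h \<delta>)"
    by (rule continuous_on_eq) (auto simp: params_def C_min_eq_step_rate)
qed

end
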